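(* Let $[\underline{H},\overline{H}]\subset(0,1)$ be a compact interval and let $\{H_j:j\in\mathbb{Z}_+\}$ be a sequence of Lipschitz functions $[0,1]\to[\underline{H},\overline{H}]$ for which there is a constant $C_0>0$ with $\nu_j\le C_0(1+j)$ for all $j\in\mathbb{Z}_+$. Let $X$ be the Gaussian Haar-based multifractional process built from $\{H_j\}$ and from independent standard Gaussian random variables $\varepsilon_{j,k}$. Then for every fixed $t\in[0,1]$, $$\mathbb{E}X^2(t)=\sum_{j=0}^{+\infty}\sum_{k=0}^{2^j-1}\left|\int_0^1 (t-s)_+^{H_j(k/2^j)-1/2}\,h_{j,k}(s)\,ds\right|^2<+\infty .$$ Therefore the process is properly defined in the $L_2$-sense, i.e. for each $t\in[0,1]$ the random series defining $X(t)$ converges in $L_2(\Omega)$.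
   Context: $\mathbb{Z}_+$ is the set of non-negative integers. $(y)_+^\beta:=y^\beta$ if $y\ge 0$ and $(y)_+^\beta:=0$ otherwise. For a Lipschitz function $H_j$ on $[0,1]$, $\nu_j:=\sup_{x\in[0,1]}|H_j(x)|+\sup_{0\le x'<x''\le 1}\frac{|H_j(x'')-H_j(x')|}{x''-x'}$. The Haar mother wavelet is $h:=\mathbb{1}_{[0,1/2)}-\mathbb{1}_{[1/2,1)}$, and $h_{j,k}(s):=2^{j/2}h(2^js-k)$ for $j\in\mathbb{Z}_+$, $k\in\{0,\dots,2^j-1\}$, $s\in\mathbb{R}$. Let $\{\varepsilon_{j,k}: j\in\mathbb{Z}_+,\ k\in\{0,\dots,2^j-1\}\}$ be independent $\mathcal{N}(0,1)$ random variables on a probability space $(\Omega,\mathcal{F},\mathbb{P})$. The Gaussian Haar-based multifractional process (GHBMP) is $$X(t):=\sum_{j=0}^{+\infty}\sum_{k=0}^{2^j-1}\left(\int_0^1 (t-s)_+^{H_j(k/2^j)-1/2}h_{j,k}(s)\,ds\right)\varepsilon_{j,k},\qquad t\in[0,1].$$ *)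

theory Defs
  imports "HOL-Probability.Probability"
begin

(* The paper's (y)_+^b.  The value at y = 0 depends on the convention for powers of 0
   (0 powr b = 0 for every b), but it only concerns a null set in the integrals below. *)
definition pos_powr :: "real \<Rightarrow> real \<Rightarrow> real" where
  "pos_powr y b = (if y \<ge> 0 then y powr b else 0)"

definition haar :: "real \<Rightarrow> real" where
  "haar s = indicat_real {0..<1/2} s - indicat_real {1/2..<1} s"

definition haar_wavelet :: "nat \<Rightarrow> nat \<Rightarrow> real \<Rightarrow> real" where
  "haar_wavelet j k s = 2 powr (real j / 2) * haar (2 ^ j * s - real k)"

(* Both suprema are suprema of bounded sets of reals exactly when f is Lipschitz on [0,1];
   the functional is only meant to be used for such f (see Lipschitz_nu_bdd_above). *)
definition Lipschitz_nu :: "(real \<Rightarrow> real) \<Rightarrow> real" where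
  "Lipschitz_nu f =
     (SUP x\<in>{0..1}. \<bar>f x\<bar>)
     + (SUP (x, y)\<in>{(x, y). 0 \<le> x \<and> x < y \<and> y \<le> 1}. \<bar>f y - f x\<bar> / (y - x))"

lemma Lipschitz_nu_bdd_above:
  assumes "L-lipschitz_on {0..1} f"
  shows "bdd_above ((\<lambda>x. \<bar>f x\<bar>) ` {0..1::real})"
    and "bdd_above ((\<lambda>(x, y). \<bar>f y - f x\<bar> / (y - x)) `
           {(x, y). 0 \<le> x \<and> x < y \<and> y \<le> (1::real)})"
proof -
  have "compact (f ` {0..1})"
    using lipschitz_on_continuous_on[OF assms] by (intro compact_continuous_image) auto
  then obtain B where "\<forall>y\<in>f ` {0..1}. \<bar>y\<bar> \<le> B"
    using compact_imp_bounded[of "f ` {0..1}"] by (auto simp: bounded_iff)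
  then show "bdd_above ((\<lambda>x. \<bar>f x\<bar>) ` {0..1})"
    by (auto intro!: bdd_aboveI[of _ B])
  show "bdd_above ((\<lambda>(x, y). \<bar>f y - f x\<bar> / (y - x)) `
           {(x, y). 0 \<le> x \<and> x < y \<and> y \<le> (1::real)})"
  proof (rule bdd_aboveI[of _ L], clarsimp)
    fix x y :: real
    assume "0 \<le> x" "x < y" "y \<le> 1"
    then show "\<bar>f y - f x\<bar> / (y - x) \<le> L"
      using lipschitz_onD[OF assms, of y x] by (auto simp: dist_real_def divide_simps)
  qed
qed

definition haar_coeff :: "(nat \<Rightarrow> real \<Rightarrow> real) \<Rightarrow> nat \<Rightarrow> nat \<Rightarrow> real \<Rightarrow> real" where
  "haar_coeff H j k t =
     (LBINT s:{0..1}. pos_powr (t - s) (H j (real k / 2 ^ j) - 1/2) * haar_wavelet j k s)"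

(* The Bochner integral in haar_coeff is a genuine one: no appeal is made to its default value
   on non-integrable functions. *)
lemma haar_coeff_integrable:
  assumes "H j (real k / 2 ^ j) > 0"
  shows "set_integrable lborel {0..1}
           (\<lambda>s. pos_powr (t - s) (H j (real k / 2 ^ j) - 1/2) * haar_wavelet j k s)"
proof -
  define b where "b = H j (real k / 2 ^ j) - 1/2"
  define T where "T = max t 0"
  have b: "b > -1" using assms by (simp add: b_def)
  have "(\<lambda>x. x powr b) absolutely_integrable_on {0..T}"
    by (intro nonnegative_absolutely_integrable_1
              integrable_on_powr_from_0[OF b]) (auto simp: T_def)
  then have "set_integrable lborel {0..T} (\<lambda>x. x powr b)"
    by (simp add: set_integrable_def integrable_completion)
  then have "integrable lborel (\<lambda>x. indicat_real {0..T} x * x powr b)"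
    by (simp add: set_integrable_def)
  from lborel_integrable_real_affine[OF this, of "-1" t]
  have *: "integrable lborel (\<lambda>s. indicat_real {0..T} (t - s) * (t - s) powr b)"
    by simp
  have meas: "haar_wavelet j k \<in> borel_measurable borel"
    unfolding haar_wavelet_def haar_def by measurable
  have "integrable lborel
          (\<lambda>s. 2 powr (real j / 2) * (indicat_real {0..T} (t - s) * (t - s) powr b))"
    using * by simp
  then show ?thesis
    unfolding set_integrable_def b_def[symmetric]
  proof (rule Bochner_Integration.integrable_bound)
    show "(\<lambda>s. indicat_real {0..1} s *\<^sub>R (pos_powr (t - s) b * haar_wavelet j k s))
            \<in> borel_measurable lborel"
      unfolding pos_powr_def using meas by measurable
    show "AE s in lborel. norm (indicat_real {0..1} s *\<^sub>R (pos_powr (t - s) b * haar_wavelet j k s))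
            \<le> norm (2 powr (real j / 2) * (indicat_real {0..T} (t - s) * (t - s) powr b))"
      by (intro AE_I2)
        (auto simp: indicator_def pos_powr_def haar_wavelet_def haar_def T_def abs_mult)
  qed
qed

definition L2_fun :: "'a measure \<Rightarrow> ('a \<Rightarrow> real) \<Rightarrow> bool" where
  "L2_fun M f \<longleftrightarrow> f \<in> borel_measurable M \<and> integrable M (\<lambda>\<omega>. (f \<omega>)\<^sup>2)"

definition L2_sums :: "'a measure \<Rightarrow> (nat \<Rightarrow> 'a \<Rightarrow> real) \<Rightarrow> ('a \<Rightarrow> real) \<Rightarrow> bool" where
  "L2_sums M F Y \<longleftrightarrow>
     (\<forall>j. L2_fun M (F j)) \<and> L2_fun M Y \<and>
     (\<lambda>n. \<integral>\<omega>. ((\<Sum>j<n. F j \<omega>) - Y \<omega>)\<^sup>2 \<partial>M) \<longlonglongrightarrow> 0"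

definition iid_std_normal :: "'a measure \<Rightarrow> (nat \<Rightarrow> nat \<Rightarrow> 'a \<Rightarrow> real) \<Rightarrow> bool" where
  "iid_std_normal M \<epsilon> \<longleftrightarrow>
     prob_space.indep_vars M (\<lambda>_. borel) (\<lambda>(j, k). \<epsilon> j k) {(j, k). k < 2 ^ j} \<and>
     (\<forall>j. \<forall>k<2 ^ j. distributed M lborel (\<epsilon> j k) std_normal_density)"

(* X is a version of the Gaussian Haar-based multifractional process: the series over j (each
   term being a finite sum over k) is summed in L2 for every t in [0,1].  This determines each
   X t up to almost sure equality. *)
definition is_GHBMP ::
  "'a measure \<Rightarrow> (nat \<Rightarrow> nat \<Rightarrow> 'a \<Rightarrow> real) \<Rightarrow> (nat \<Rightarrow> real \<Rightarrow> real) \<Rightarrow> (real \<Rightarrow> 'a \<Rightarrow> real) \<Rightarrow> bool"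
  where
  "is_GHBMP M \<epsilon> H X \<longleftrightarrow>
     (\<forall>t\<in>{0..1}. L2_sums M (\<lambda>j \<omega>. \<Sum>k<2 ^ j. haar_coeff H j k t * \<epsilon> j k \<omega>) (X t))"

end

theory Submission
  imports Defs
begin

text \<open>Let \<open>K\<close> be the integer part of \<open>t 2\<^sup>j\<close>. The coefficient with index \<open>(j, k)\<close> vanishes for \<open>k > K\<close>.
  For \<open>k \<ge> K - 1\<close>, integrating the absolute value of the kernel bounds its square by a constant times
  \<open>2 powr (-2 h j)\<close>, where \<open>h\<close> is the lower bound of the Hurst functions. For \<open>k \<le> K - 2\<close> the kernel
  is smooth on the support of the wavelet, and the cancellation of the wavelet improves this to
  \<open>2 powr (-2 h j) * (K - k - 1) powr (2 h - 3)\<close>, which is summable in \<open>k\<close> uniformly in \<open>j\<close> because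
  \<open>h < 1\<close>. Hence the variance of the \<open>j\<close>-th level of the series decays geometrically in \<open>j\<close>, and the
  convergence and the formula for the second moment follow from the orthonormality of the
  Gaussian variables.\<close>

section \<open>Estimates of the Haar coefficients\<close>

lemma haar_wavelet_eq:
  "haar_wavelet j k s = 2 powr (real j / 2) *
     (indicat_real {real k / 2 ^ j..<real k / 2 ^ j + 1 / 2 ^ j / 2} s
      - indicat_real {real k / 2 ^ j + 1 / 2 ^ j / 2..<real k / 2 ^ j + 1 / 2 ^ j} s)"
  by (auto simp: haar_wavelet_def haar_def indicator_def field_simps)

lemma haar_wavelet_support:
  assumes "haar_wavelet j k s \<noteq> 0"
  shows "real k / 2 ^ j \<le> s" "s < (real k + 1) / 2 ^ j"
  using assms by (auto simp: haar_wavelet_def haar_def of_bool_def field_simps indicator_def split: if_splits)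

lemma haar_wavelet_abs_le: "\<bar>haar_wavelet j k s\<bar> \<le> 2 powr (real j / 2)"
  by (auto simp: haar_wavelet_def haar_def indicator_def)

text \<open>Lets the restriction to the unit interval be dropped from integrals of a wavelet:
  \<open>k < 2 ^ j\<close> gives \<open>k + 1 \<le> 2 ^ j\<close>.\<close>

lemma interval_dyadic_subset_unit:
  assumes "k < 2 ^ j" "real k / 2 ^ j \<le> s" "s < (real k + 1) / 2 ^ j"
  shows "s \<in> {0..1}"
proof -
  have "real k + 1 \<le> 2 ^ j"
    using assms(1) by (metis Suc_eq_plus1 Suc_leI of_nat_1 of_nat_add of_nat_le_iff of_nat_numeral of_nat_power)
  then have "(real k + 1) / 2 ^ j \<le> 1"
    by simp
  moreover have "0 \<le> real k / 2 ^ j"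
    by simp
  ultimately show ?thesis
    using assms by (simp only: atLeastAtMost_iff) linarith
qed

text \<open>The two halves of the support have equal length and carry opposite signs.\<close>

lemma haar_wavelet_mean:
  assumes "k < 2 ^ j"
  shows "set_integrable lborel {0..1} (haar_wavelet j k)" "(LBINT s:{0..1}. haar_wavelet j k s) = 0"
proof -
  have *: "indicat_real {0..1} s *\<^sub>R haar_wavelet j k s = haar_wavelet j k s" for s
    using interval_dyadic_subset_unit[OF assms] haar_wavelet_support[of j k s]
    by (cases "haar_wavelet j k s = 0") (auto simp: indicator_def)
  show "set_integrable lborel {0..1} (haar_wavelet j k)"
    unfolding set_integrable_def * unfolding haar_wavelet_eq
    by (intro integrable_mult_right Bochner_Integration.integrable_diff integrable_real_indicator)
      (simp_all add: field_simps)
  let ?A = "{real k / 2 ^ j..<real k / 2 ^ j + 1 / 2 ^ j / 2}"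
  let ?B = "{real k / 2 ^ j + 1 / 2 ^ j / 2..<real k / 2 ^ j + 1 / 2 ^ j}"
  have "(LBINT s. indicat_real ?A s - indicat_real ?B s) = measure lborel ?A - measure lborel ?B"
    by (subst Bochner_Integration.integral_diff; (intro integrable_real_indicator)?)
      (simp_all add: field_simps)
  also have "\<dots> = 0"
    by (simp add: field_simps)
  finally show "(LBINT s:{0..1}. haar_wavelet j k s) = 0"
    unfolding set_lebesgue_integral_def * unfolding haar_wavelet_eq by simp
qed

text \<open>On the support of the wavelet \<open>t - s \<le> 0\<close>, and the boundary case
  \<open>s = t\<close> contributes nothing because \<open>0 powr b = 0\<close>.\<close>

lemma haar_coeff_eq_0:
  assumes "t \<le> real k / 2 ^ j"
  shows "haar_coeff H j k t = 0"
proof -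
  have "pos_powr (t - s) b * haar_wavelet j k s = 0" for s b
    using assms haar_wavelet_support[of j k s]
    by (cases "haar_wavelet j k s = 0") (auto simp: pos_powr_def)
  then show ?thesis
    unfolding haar_coeff_def set_lebesgue_integral_def by (simp only: scaleR_zero_right) simp
qed

section \<open>Bounds for a single coefficient\<close>

lemma has_bochner_integral_pos_powr:
  assumes "b > -1" "a \<le> t"
  shows "has_bochner_integral lborel (\<lambda>s. indicat_real {a..} s * pos_powr (t - s) b)
           ((t - a) powr (b + 1) / (b + 1))"
proof -
  have ab: "(\<lambda>x. x powr b) absolutely_integrable_on {0..t - a}"
    using assms by (intro nonnegative_absolutely_integrable_1 integrable_on_powr_from_0) auto
  then have int: "set_integrable lborel {0..t - a} (\<lambda>x. x powr b)"
    by (simp add: set_integrable_def integrable_completion)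
  have "(LBINT x:{0..t - a}. x powr b) = integral {0..t - a} (\<lambda>x. x powr b)"
    using int by (rule set_borel_integral_eq_integral)
  also have "\<dots> = (t - a) powr (b + 1) / (b + 1)"
    using has_integral_powr_from_0[of b "t - a"] assms by (intro integral_unique) auto
  finally have "has_bochner_integral lborel (\<lambda>x. indicat_real {0..t - a} x * x powr b)
      ((t - a) powr (b + 1) / (b + 1))"
    using int by (simp add: has_bochner_integral_iff set_integrable_def set_lebesgue_integral_def)
  \<comment> \<open>Reflection of the variable at \<open>t\<close>, with Jacobian 1. The cut-off of
    \<open>pos_powr\<close> at \<open>s = t\<close> then takes the place of an upper integration
    limit.\<close>
  then have "has_bochner_integral lborel
      (\<lambda>s. indicat_real {0..t - a} (t + (-1) * s) * (t + (-1) * s) powr b)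
      ((t - a) powr (b + 1) / (b + 1) /\<^sub>R \<bar>-1\<bar>)"
    by (intro lborel_has_bochner_integral_real_affine_iff[THEN iffD1]) auto
  moreover have "indicat_real {0..t - a} (t + (-1) * s) * (t + (-1) * s) powr b
      = indicat_real {a..} s * pos_powr (t - s) b" for s
    by (auto simp: indicator_def pos_powr_def)
  ultimately show ?thesis
    by simp
qed

text \<open>No cancellation is used: the wavelet is replaced by its height and the kernel is
  integrated from the left end of the support up to \<open>t\<close>. This is sharp enough when
  \<open>t\<close> is within a few dyadic lengths of that end.\<close>

lemma haar_coeff_abs_le_near:
  fixes H j k
  defines "b \<equiv> H j (real k / 2 ^ j) - 1/2"
  assumes "H j (real k / 2 ^ j) > 0" "real k / 2 ^ j \<le> t"
  shows "\<bar>haar_coeff H j k t\<bar>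
    \<le> 2 powr (real j / 2) * ((t - real k / 2 ^ j) powr (b + 1) / (b + 1))"
proof -
  let ?a = "real k / 2 ^ j"
  have b: "b > -1"
    using assms by (simp add: b_def)
  note p = has_bochner_integral_pos_powr[OF b assms(3)]
  have "norm (haar_coeff H j k t) \<le> (\<integral>s. 2 powr (real j / 2) * (indicat_real {?a..} s * pos_powr (t - s) b) \<partial>lborel)"
    unfolding haar_coeff_def b_def[symmetric] set_lebesgue_integral_def
  proof (rule Bochner_Integration.integral_norm_bound_integral)
    show "integrable lborel (\<lambda>s. indicat_real {0..1} s *\<^sub>R (pos_powr (t - s) b * haar_wavelet j k s))"
      using haar_coeff_integrable[of H j k t] assms by (simp add: b_def set_integrable_def)
    show "integrable lborel (\<lambda>s. 2 powr (real j / 2) * (indicat_real {?a..} s * pos_powr (t - s) b))"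
      using p by (auto simp: has_bochner_integral_iff)
    show "norm (indicat_real {0..1} s *\<^sub>R (pos_powr (t - s) b * haar_wavelet j k s))
        \<le> 2 powr (real j / 2) * (indicat_real {?a..} s * pos_powr (t - s) b)" for s
    proof (cases "haar_wavelet j k s = 0")
      case False
      have "pos_powr (t - s) b \<ge> 0"
        by (simp add: pos_powr_def)
      then show ?thesis
        using haar_wavelet_support(1)[OF False] haar_wavelet_abs_le[of j k s]
        by (auto simp: indicator_def abs_mult mult.commute[of "2 powr _"] intro!: mult_left_mono)
    qed (simp add: pos_powr_def)
  qed
  also have "\<dots> = 2 powr (real j / 2) * ((t - ?a) powr (b + 1) / (b + 1))"
    using p by (simp add: has_bochner_integral_iff)
  finally show ?thesis
    by simp
qed

text \<open>Mean value theorem on \<open>{q..}\<close>: since \<open>b - 1 \<le> 0\<close>, the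
  derivative of the power is largest in absolute value at \<open>q\<close>.\<close>

lemma abs_powr_diff_le:
  fixes b q x y :: real
  assumes "0 < q" "q \<le> x" "q \<le> y" "b \<le> 1"
  shows "\<bar>x powr b - y powr b\<bar> \<le> \<bar>b\<bar> * q powr (b - 1) * \<bar>x - y\<bar>"
proof -
  have "norm (x powr b - y powr b) \<le> \<bar>b\<bar> * q powr (b - 1) * norm (x - y)"
  proof (rule field_differentiable_bound[where S = "{q..}"])
    show "((\<lambda>z. z powr b) has_field_derivative b * z powr (b - 1)) (at z within {q..})"
      if "z \<in> {q..}" for z
      using that assms by (auto intro!: derivative_eq_intros simp: has_field_derivative_at_within)
    show "norm (b * z powr (b - 1)) \<le> \<bar>b\<bar> * q powr (b - 1)" if "z \<in> {q..}" for z
      using that assms by (auto simp: abs_mult intro!: mult_left_mono powr_mono2')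
  qed (use assms in auto)
  then show ?thesis
    by simp
qed

text \<open>The mean of the wavelet vanishes, so the kernel may be replaced by its increment over the
  support, which is estimated by the mean value theorem.\<close>

lemma haar_coeff_abs_le_far:
  fixes H j k
  defines "b \<equiv> H j (real k / 2 ^ j) - 1/2"
  assumes k: "k < 2 ^ j" and H: "0 < H j (real k / 2 ^ j)" "H j (real k / 2 ^ j) < 1"
    and q: "0 < q" "q \<le> t - (real k + 1) / 2 ^ j"
  shows "\<bar>haar_coeff H j k t\<bar> \<le> 2 powr (real j / 2) * (1 / 2 ^ j)\<^sup>2 * q powr (b - 1)"
proof -
  let ?a = "real k / 2 ^ j" and ?e = "(real k + 1) / 2 ^ j" and ?w = "2 powr (real j / 2)"
  \<comment> \<open>The kernel at the left end of the support, the constant to be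
    subtracted.\<close>
  define v where "v = (t - ?a) powr b"
  \<comment> \<open>Derivative bound times length of the support times height of the wavelet; the
    factor \<open>\<bar>b\<bar>\<close> is estimated by 1.\<close>
  define B where "B = q powr (b - 1) * (1 / 2 ^ j) * ?w"
  have b: "\<bar>b\<bar> \<le> 1"
    using H by (auto simp: b_def)
  have ae: "?a \<le> ?e" "?e - ?a = 1 / 2 ^ j"
    by (auto simp: field_simps)
  have i1: "set_integrable lborel {0..1} (\<lambda>s. pos_powr (t - s) b * haar_wavelet j k s)"
    using haar_coeff_integrable[of H j k t] H by (simp add: b_def)
  have i2: "set_integrable lborel {0..1} (\<lambda>s. v * haar_wavelet j k s)"
    using haar_wavelet_mean[OF k] by simp
  have "haar_coeff H j k t = (LBINT s:{0..1}. pos_powr (t - s) b * haar_wavelet j k s)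
      - (LBINT s:{0..1}. v * haar_wavelet j k s)"
    using haar_wavelet_mean[OF k] by (simp add: haar_coeff_def b_def)
  also have "\<dots> = (LBINT s:{0..1}. pos_powr (t - s) b * haar_wavelet j k s - v * haar_wavelet j k s)"
    using i1 i2 by (simp add: set_integral_diff)
  finally have c: "haar_coeff H j k t = \<dots>" .
  have "norm (haar_coeff H j k t) \<le> (\<integral>s. B * indicat_real {?a..?e} s \<partial>lborel)"
    unfolding c set_lebesgue_integral_def
  proof (rule Bochner_Integration.integral_norm_bound_integral)
    show "integrable lborel (\<lambda>s. indicat_real {0..1} s *\<^sub>R (pos_powr (t - s) b * haar_wavelet j k s - v * haar_wavelet j k s))"
      using set_integral_diff(1)[OF i1 i2] by (simp add: set_integrable_def)
    show "integrable lborel (\<lambda>s. B * indicat_real {?a..?e} s)"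
      by (intro integrable_mult_right integrable_real_indicator) (simp_all add: emeasure_lborel_Icc_eq)
    show "norm (indicat_real {0..1} s *\<^sub>R (pos_powr (t - s) b * haar_wavelet j k s - v * haar_wavelet j k s))
        \<le> B * indicat_real {?a..?e} s" for s
    proof (cases "haar_wavelet j k s = 0")
      case False
      note sup = haar_wavelet_support[OF False]
      \<comment> \<open>The gap \<open>q\<close> is measured from the right end of the support, so
        both arguments of the power are at least \<open>q\<close>.\<close>
      have "\<bar>pos_powr (t - s) b - v\<bar> \<le> \<bar>b\<bar> * q powr (b - 1) * \<bar>(t - s) - (t - ?a)\<bar>"
        using abs_powr_diff_le[of q "t - s" "t - ?a" b] q sup ae b
        by (simp add: pos_powr_def v_def)
      also have "\<dots> \<le> 1 * q powr (b - 1) * (1 / 2 ^ j)"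
        using sup ae b by (intro mult_mono) auto
      finally have "\<bar>pos_powr (t - s) b - v\<bar> * \<bar>haar_wavelet j k s\<bar> \<le> B"
        unfolding B_def using haar_wavelet_abs_le[of j k s] by (intro mult_mono) auto
      moreover have "0 \<le> B"
        by (simp add: B_def)
      ultimately show ?thesis
        using sup by (simp add: indicator_def abs_mult left_diff_distrib[symmetric])
    qed (simp add: B_def)
  qed
  \<comment> \<open>The second factor \<open>1 / 2 ^ j\<close> comes from integrating the constant
    \<open>B\<close> over the support.\<close>
  also have "\<dots> = ?w * (1 / 2 ^ j)\<^sup>2 * q powr (b - 1)"
    using ae by (simp add: B_def power2_eq_square)
  finally show ?thesis
    by simp
qed

text \<open>The index \<open>n\<close> is the distance, in dyadic intervals, from the interval containing \<open>t\<close> to the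
  support of the wavelet. The kernel may be singular there for \<open>n \<le> 1\<close>, where only the crude bound
  on the absolute value of the coefficient is available; 32 is the constant it produces.\<close>

definition dyadic_weight :: "real \<Rightarrow> nat \<Rightarrow> real" where
  "dyadic_weight h n = (if n \<le> 1 then 32 else real (n - 1) powr (2 * h - 3))"

lemma dyadic_weight_nonneg: "0 \<le> dyadic_weight h n"
  by (simp add: dyadic_weight_def)

text \<open>Apart from the first two values this is the series of \<open>n powr (2 * h - 3)\<close>,
  whose exponent is below -1 because \<open>h < 1\<close>.\<close>

lemma summable_dyadic_weight:
  assumes "h < 1"
  shows "summable (dyadic_weight h)"
proof -
  have "summable (\<lambda>n. real (Suc n) powr (2 * h - 3))"
    using assms by (subst summable_Suc_iff) (simp add: summable_real_powr_iff)
  also have "(\<lambda>n. real (Suc n) powr (2 * h - 3)) = (\<lambda>n. dyadic_weight h (n + 2))"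
    by (auto simp: dyadic_weight_def)
  finally show ?thesis
    by (subst (asm) summable_iff_shift)
qed

text \<open>The crude bound serves for \<open>K - k \<le> 1\<close>, the one with cancellation
  otherwise. In both, the Hurst value may be lowered to \<open>h\<close> because the base of the
  power is at most 1.\<close>

lemma haar_coeff_square_le:
  fixes H :: "nat \<Rightarrow> real \<Rightarrow> real"
  assumes k: "k < 2 ^ j" and h: "0 < h" "h \<le> H j (real k / 2 ^ j)" "H j (real k / 2 ^ j) < 1"
    and t: "t \<le> 1" and K: "real K \<le> t * 2 ^ j" "t * 2 ^ j < real K + 1" "k \<le> K"
  shows "(haar_coeff H j k t)\<^sup>2 \<le> (1 / 2 ^ j) powr (2 * h) * dyadic_weight h (K - k)"
proof -
  define d :: real where "d = 1 / 2 ^ j"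
  define b where "b = H j (real k / 2 ^ j) - 1/2"
  let ?w = "2 powr (real j / 2)"
  have d: "0 < d" "d \<le> 1"
    by (auto simp: d_def)
  have w: "?w\<^sup>2 = 1 / d"
    by (simp add: d_def powr_powr powr_realpow[symmetric] flip: powr_numeral)
  have b: "h \<le> b + 1/2" "b < 1/2"
    using h by (auto simp: b_def)
  have Kd: "real K * d \<le> t" "t < (real K + 1) * d"
    using K by (auto simp: d_def field_simps)
  have kd: "real k / 2 ^ j = real k * d" "(real k + 1) / 2 ^ j = (real k + 1) * d"
    by (auto simp: d_def)
  show ?thesis
  proof (cases "K - k \<le> 1")
    case True
    define y where "y = t - real k * d"
    have "real K \<le> real k + 1"
      using True by linarith
    then have "real K * d \<le> (real k + 1) * d"
      using d by (intro mult_right_mono) auto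
    \<comment> \<open>The interval containing \<open>t\<close> is the support or its right
      neighbour, so \<open>t\<close> is within two lengths of the left end.\<close>
    then have y2: "y \<le> 2 * d"
      using Kd by (simp add: y_def algebra_simps)
    have "real k * d \<le> real K * d"
      using K d by (intro mult_right_mono) auto
    then have y0: "0 \<le> y"
      using Kd by (simp add: y_def)
    have "\<bar>haar_coeff H j k t\<bar> \<le> ?w * (y powr (b + 1) / (b + 1))"
      using haar_coeff_abs_le_near[of H j k t] h y0 by (simp add: b_def y_def kd)
    \<comment> \<open>The denominator is at least 1/2, as \<open>b + 1/2\<close> is a Hurst value
      and hence positive.\<close>
    also have "y powr (b + 1) / (b + 1) \<le> (2 * d) powr (b + 1) / (1/2)"
      using y0 y2 b h by (intro frac_le powr_mono2) auto
    also have "(2 * d) powr (b + 1) = 2 powr (b + 1) * d powr (b + 1)"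
      using d by (simp add: powr_mult)
    also have "\<dots> \<le> 2 powr (3/2) * d powr (h + 1/2)"
      using d b by (intro mult_mono powr_mono powr_mono') auto
    finally have "\<bar>haar_coeff H j k t\<bar> \<le> ?w * (2 powr (3/2) * d powr (h + 1/2) / (1/2))"
      by (simp add: mult_left_mono)
    then have "\<bar>haar_coeff H j k t\<bar>\<^sup>2 \<le> (?w * (2 powr (3/2) * d powr (h + 1/2) / (1/2)))\<^sup>2"
      by (intro power_mono) auto
    \<comment> \<open>The constant 32 arises as 4 * 8: 4 from the denominator 1/2, 8 from the power
      of 2. The squared height \<open>1 / d\<close> is cancelled by the extra factor
      \<open>d\<close> below.\<close>
    also have "\<dots> = 4 * (2 powr (3/2))\<^sup>2 * (d powr (h + 1/2))\<^sup>2 / d"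
      by (simp add: power_mult_distrib w)
    also have "(2 powr (3/2))\<^sup>2 = (8::real)"
      by (simp add: powr_powr flip: powr_numeral)
    also have "(d powr (h + 1/2))\<^sup>2 = d powr (2 * h) * d"
      using d by (simp add: power2_eq_square powr_add[symmetric] powr_mult_base mult.commute add.commute)
    finally show ?thesis
      using d True by (simp add: dyadic_weight_def d_def)
  next
    case False
    \<comment> \<open>The number of full dyadic intervals between the support and the interval
      containing \<open>t\<close>; the subtraction is not truncated, as
      \<open>K - k \<ge> 2\<close>.\<close>
    define n where "n = real (K - k - 1)"
    have n: "n \<ge> 1" "real K = real k + 1 + n"
      using False K by (auto simp: n_def)
    have q: "n * d \<le> t - (real k + 1) * d"
      using Kd n by (simp add: algebra_simps)
    have q0: "0 < n * d"
      using n d by simp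
    \<comment> \<open>A base of at most 1 is what allows the exponent to be lowered; here
      \<open>t \<le> 1\<close> enters.\<close>
    have q1: "n * d \<le> 1"
    proof -
      have "0 \<le> (real k + 1) * d"
        using d by simp
      with q t show ?thesis
        by linarith
    qed
    have "\<bar>haar_coeff H j k t\<bar> \<le> ?w * d\<^sup>2 * (n * d) powr (b - 1)"
      using haar_coeff_abs_le_far[of k j H "n * d" t] k h q q0 by (simp add: b_def kd) (simp add: d_def)
    also have "\<dots> \<le> ?w * d\<^sup>2 * (n * d) powr (h - 3/2)"
      using q0 q1 b by (intro mult_left_mono powr_mono') auto
    finally have "\<bar>haar_coeff H j k t\<bar>\<^sup>2 \<le> (?w * d\<^sup>2 * (n * d) powr (h - 3/2))\<^sup>2"
      by (intro power_mono) auto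
    also have "\<dots> = d ^ 3 * (n * d) powr (2 * h - 3)"
    proof -
      have "((n * d) powr (h - 3/2))\<^sup>2 = (n * d) powr (2 * h - 3)"
        by (simp add: power2_eq_square powr_add[symmetric])
      moreover have "1 / d * (d\<^sup>2)\<^sup>2 = d ^ 3"
        using d by (simp add: power2_eq_square power3_eq_cube)
      ultimately show ?thesis
        unfolding power_mult_distrib w by simp
    qed
    also have "\<dots> = d powr 3 * d powr (2 * h - 3) * n powr (2 * h - 3)"
      using d n by (simp add: powr_mult)
    also have "d powr 3 * d powr (2 * h - 3) = d powr (2 * h)"
      by (simp add: powr_add[symmetric])
    finally show ?thesis
      using False by (simp add: dyadic_weight_def d_def n_def)
  qed
qed

text \<open>Summing over the distance \<open>K - k\<close> instead of \<open>k\<close> bounds the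
  weights by one convergent series, independent of \<open>j\<close> and \<open>t\<close>; the scale
  factor gives the geometric decay.\<close>

lemma sum_haar_coeff_square_le:
  fixes H :: "nat \<Rightarrow> real \<Rightarrow> real"
  assumes h: "0 < h" "h < 1" and H: "\<And>x. x \<in> {0..1} \<Longrightarrow> h \<le> H j x \<and> H j x < 1"
    and t: "t \<in> {0..1}"
  shows "(\<Sum>k<2 ^ j. (haar_coeff H j k t)\<^sup>2) \<le> (\<Sum>n. dyadic_weight h n) * (2 powr (- 2 * h)) ^ j"
proof -
  \<comment> \<open>For \<open>t = 1\<close> this is \<open>2 ^ j\<close>, one more than the last
    index of the level, so the sum is later extended to all \<open>k \<le> K\<close>.\<close>
  define K where "K = nat \<lfloor>t * 2 ^ j\<rfloor>"
  have K: "real K \<le> t * 2 ^ j" "t * 2 ^ j < real K + 1"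
    using t by (auto simp: K_def of_nat_nat)
  define D where "D = (1 / 2 ^ j :: real) powr (2 * h)"
  have "(1 / 2 ^ j :: real) = 2 powr (- real j)"
    by (simp add: powr_minus powr_realpow divide_inverse)
  then have D: "D = (2 powr (- 2 * h)) ^ j"
    by (simp add: D_def powr_powr powr_power mult_ac)
  have "(\<Sum>k<2 ^ j. (haar_coeff H j k t)\<^sup>2)
      \<le> (\<Sum>k<2 ^ j. if k \<le> K then D * dyadic_weight h (K - k) else 0)"
  proof (rule sum_mono)
    fix k :: nat assume k: "k \<in> {..<2 ^ j}"
    show "(haar_coeff H j k t)\<^sup>2 \<le> (if k \<le> K then D * dyadic_weight h (K - k) else 0)"
    proof (cases "k \<le> K")
      case True
      have "real k \<le> real (2 ^ j)"
        using k by (intro of_nat_mono) simp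
      then have "real k / 2 ^ j \<in> {0..1}"
        by simp
      then show ?thesis
        using haar_coeff_square_le[of k j h H t K] True k K h t H
        by (auto simp: D_def)
    next
      case False
      then have "real K + 1 \<le> real k"
        by simp
      then have "t \<le> real k / 2 ^ j"
        using K by (simp add: field_simps)
      then show ?thesis
        using False by (simp add: haar_coeff_eq_0)
    qed
  qed
  also have "\<dots> = (\<Sum>k\<in>{..<2 ^ j} \<inter> {..K}. D * dyadic_weight h (K - k))"
    by (simp add: sum.If_cases atMost_def)
  also have "\<dots> \<le> (\<Sum>k\<in>{..K}. D * dyadic_weight h (K - k))"
    by (intro sum_mono2) (auto simp: D_def dyadic_weight_nonneg)
  also have "\<dots> = D * (\<Sum>k\<le>K. dyadic_weight h k)"
    using sum.nat_diff_reindex[of "dyadic_weight h" "Suc K"]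
    by (simp add: sum_distrib_left[symmetric] lessThan_Suc_atMost)
  also have "\<dots> \<le> D * (\<Sum>n. dyadic_weight h n)"
    using summable_dyadic_weight[OF h(2)]
    by (intro mult_left_mono sum_le_suminf) (auto simp: D_def dyadic_weight_nonneg)
  finally show ?thesis
    by (simp add: D mult.commute)
qed

section \<open>Square integrable functions and orthonormal series\<close>

lemma L2_fun_mult_integrable:
  assumes "L2_fun M f" "L2_fun M g"
  shows "integrable M (\<lambda>x. f x * g x)"
proof (rule Bochner_Integration.integrable_bound)
  show "integrable M (\<lambda>x. (f x)\<^sup>2 + (g x)\<^sup>2)"
    using assms by (simp add: L2_fun_def)
  show "(\<lambda>x. f x * g x) \<in> borel_measurable M"
    using assms by (auto simp: L2_fun_def)
  have "\<bar>a * b\<bar> \<le> a\<^sup>2 + b\<^sup>2" for a b :: real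
  proof -
    have "2 * \<bar>a * b\<bar> \<le> a\<^sup>2 + b\<^sup>2"
      using sum_squares_bound[of "\<bar>a\<bar>" "\<bar>b\<bar>"] by (simp add: abs_mult mult.assoc)
    then show ?thesis
      using abs_ge_zero[of "a * b"] by linarith
  qed
  then show "AE x in M. norm (f x * g x) \<le> norm ((f x)\<^sup>2 + (g x)\<^sup>2)"
    by (intro AE_I2) (simp add: abs_of_nonneg)
qed

lemma L2_fun_add:
  assumes "L2_fun M f" "L2_fun M g"
  shows "L2_fun M (\<lambda>x. f x + g x)"
  using assms L2_fun_mult_integrable[OF assms]
  by (auto simp: L2_fun_def power2_sum mult.assoc)

lemma L2_fun_cmult:
  assumes "L2_fun M f"
  shows "L2_fun M (\<lambda>x. c * f x)"
  using assms by (auto simp: L2_fun_def power_mult_distrib)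

lemma L2_fun_diff:
  assumes "L2_fun M f" "L2_fun M g"
  shows "L2_fun M (\<lambda>x. f x - g x)"
  using L2_fun_add[OF assms(1) L2_fun_cmult[OF assms(2), of "-1"]] by simp

lemma L2_fun_sum:
  assumes "\<And>i. i \<in> I \<Longrightarrow> L2_fun M (f i)"
  shows "L2_fun M (\<lambda>x. \<Sum>i\<in>I. f i x)"
  using assms
proof (induction I rule: infinite_finite_induct)
  case (insert i I)
  then show ?case by (simp add: L2_fun_add)
qed (simp_all add: L2_fun_def)

text \<open>Transferred from \<open>Cauchy_Schwarz_nn_integral\<close>; square integrability makes
  all integrals involved finite.\<close>

lemma L2_Cauchy_Schwarz:
  assumes "L2_fun M f" "L2_fun M g"
  shows "(\<integral>x. \<bar>f x * g x\<bar> \<partial>M) \<le> sqrt (\<integral>x. (f x)\<^sup>2 \<partial>M) * sqrt (\<integral>x. (g x)\<^sup>2 \<partial>M)"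
proof -
  have [measurable]: "f \<in> borel_measurable M" "g \<in> borel_measurable M"
    using assms by (auto simp: L2_fun_def)
  have sq: "(\<integral>\<^sup>+x. (ennreal \<bar>u x\<bar>)\<^sup>2 \<partial>M) = ennreal (\<integral>x. (u x)\<^sup>2 \<partial>M)" if "L2_fun M u" for u
    using that by (subst nn_integral_eq_integral[symmetric]) (auto simp: L2_fun_def ennreal_power)
  have "ennreal ((\<integral>x. \<bar>f x * g x\<bar> \<partial>M)\<^sup>2) = (\<integral>\<^sup>+x. ennreal \<bar>f x * g x\<bar> \<partial>M)\<^sup>2"
    using L2_fun_mult_integrable[OF assms]
    by (subst nn_integral_eq_integral) (auto simp: ennreal_power)
  also have "\<dots> = (\<integral>\<^sup>+x. ennreal \<bar>f x\<bar> * ennreal \<bar>g x\<bar> \<partial>M)\<^sup>2"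
    by (simp add: abs_mult ennreal_mult)
  also have "\<dots> \<le> (\<integral>\<^sup>+x. (ennreal \<bar>f x\<bar>)\<^sup>2 \<partial>M) * (\<integral>\<^sup>+x. (ennreal \<bar>g x\<bar>)\<^sup>2 \<partial>M)"
    by (rule Cauchy_Schwarz_nn_integral) auto
  also have "\<dots> = ennreal ((\<integral>x. (f x)\<^sup>2 \<partial>M) * (\<integral>x. (g x)\<^sup>2 \<partial>M))"
    by (simp add: sq assms ennreal_mult)
  finally have "(\<integral>x. \<bar>f x * g x\<bar> \<partial>M)\<^sup>2 \<le> (\<integral>x. (f x)\<^sup>2 \<partial>M) * (\<integral>x. (g x)\<^sup>2 \<partial>M)"
    by simp
  then show ?thesis
    by (metis real_le_rsqrt real_sqrt_mult)
qed

text \<open>Continuity of the norm: with \<open>D n\<close> the error of the partial sum, its square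
  is \<open>(D n + Y)\<^sup>2\<close>, and Cauchy-Schwarz controls the cross term.\<close>

lemma L2_sums_integral_square:
  assumes "L2_sums M F Y"
  shows "(\<lambda>n. \<integral>x. (\<Sum>j<n. F j x)\<^sup>2 \<partial>M) \<longlonglongrightarrow> (\<integral>x. (Y x)\<^sup>2 \<partial>M)"
proof -
  define D where "D = (\<lambda>n x. (\<Sum>j<n. F j x) - Y x)"
  define d where "d = (\<lambda>n. \<integral>x. (D n x)\<^sup>2 \<partial>M)"
  define y where "y = (\<integral>x. (Y x)\<^sup>2 \<partial>M)"
  have Y: "L2_fun M Y" and F: "L2_fun M (F j)" and d: "d \<longlonglongrightarrow> 0" for j
    using assms by (auto simp: L2_sums_def d_def D_def)
  have D: "L2_fun M (D n)" for n
    unfolding D_def by (intro L2_fun_diff L2_fun_sum F Y)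
  have "\<bar>(\<integral>x. (\<Sum>j<n. F j x)\<^sup>2 \<partial>M) - y\<bar> \<le> d n + 2 * (sqrt (d n) * sqrt y)" for n
  proof -
    have int: "integrable M (\<lambda>x. (D n x)\<^sup>2)" "integrable M (\<lambda>x. (Y x)\<^sup>2)"
      "integrable M (\<lambda>x. D n x * Y x)"
      using D Y L2_fun_mult_integrable[OF D Y] by (auto simp: L2_fun_def)
    have "(\<integral>x. (\<Sum>j<n. F j x)\<^sup>2 \<partial>M) = (\<integral>x. (D n x)\<^sup>2 + (Y x)\<^sup>2 + 2 * (D n x * Y x) \<partial>M)"
      by (intro Bochner_Integration.integral_cong) (auto simp: D_def power2_eq_square algebra_simps)
    also have "\<dots> = d n + y + 2 * (\<integral>x. D n x * Y x \<partial>M)"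
      using int by (simp add: d_def y_def)
    finally have "(\<integral>x. (\<Sum>j<n. F j x)\<^sup>2 \<partial>M) - y = d n + 2 * (\<integral>x. D n x * Y x \<partial>M)"
      by simp
    moreover have "\<bar>\<integral>x. D n x * Y x \<partial>M\<bar> \<le> sqrt (d n) * sqrt y"
      using L2_Cauchy_Schwarz[OF D Y, of n] integral_abs_bound[of M "\<lambda>x. D n x * Y x"]
      unfolding d_def y_def by linarith
    moreover have "0 \<le> d n"
      by (simp add: d_def)
    ultimately show ?thesis
      by linarith
  qed
  moreover have "(\<lambda>n. d n + 2 * (sqrt (d n) * sqrt y)) \<longlonglongrightarrow> 0 + 2 * (sqrt 0 * sqrt y)"
    by (intro tendsto_intros d)
  ultimately have "(\<lambda>n. (\<integral>x. (\<Sum>j<n. F j x)\<^sup>2 \<partial>M) - y) \<longlonglongrightarrow> 0"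
    by (intro Lim_null_comparison[where f = "\<lambda>n. (\<integral>x. (\<Sum>j<n. F j x)\<^sup>2 \<partial>M) - y"]) auto
  then show ?thesis
    unfolding y_def by (rule LIM_zero_cancel)
qed

text \<open>Square-root summability gives absolute almost sure convergence, so the limit can be taken
  pointwise, and Fatou's lemma turns it into an \<open>L\<^sup>2\<close> limit; completeness of \<open>L\<^sup>2\<close> is not needed.\<close>

lemma (in prob_space) L2_sums_exists:
  fixes F :: "nat \<Rightarrow> 'a \<Rightarrow> real"
  assumes F: "\<And>j. L2_fun M (F j)"
    and s: "\<And>J. finite J \<Longrightarrow> (\<integral>x. (\<Sum>j\<in>J. F j x)\<^sup>2 \<partial>M) \<le> (\<Sum>j\<in>J. s j)"
    and s0: "\<And>j. 0 \<le> s j"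
    and sum_s: "summable s" and sum_sqrt: "summable (\<lambda>j. sqrt (s j))"
  shows "\<exists>Y. L2_sums M F Y"
proof -
  \<comment> \<open>Where the series diverges this value is unspecified; such points form a null set
    by \<open>lim\<close>.\<close>
  define Y where "Y = (\<lambda>x. \<Sum>j. F j x)"
  have [measurable]: "F j \<in> borel_measurable M" for j
    using F by (simp add: L2_fun_def)
  have [measurable]: "Y \<in> borel_measurable M"
    unfolding Y_def by measurable
  have one: "L2_fun M (\<lambda>_. 1)"
    by (simp add: L2_fun_def)
  \<comment> \<open>Cauchy-Schwarz against the constant 1, which has norm 1 on a probability
    space.\<close>
  have L1: "(\<integral>\<^sup>+x. ennreal \<bar>F j x\<bar> \<partial>M) \<le> ennreal (sqrt (s j))" for j
  proof -
    have "(\<integral>x. \<bar>F j x\<bar> \<partial>M) \<le> sqrt (\<integral>x. (F j x)\<^sup>2 \<partial>M)"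
      using L2_Cauchy_Schwarz[OF F one, of j] by (simp add: prob_space)
    also have "\<dots> \<le> sqrt (s j)"
      using s[of "{j}"] by simp
    finally show ?thesis
      using L2_fun_mult_integrable[OF F one, of j]
      by (subst nn_integral_eq_integral) (auto intro!: ennreal_leI)
  qed
  have "(\<integral>\<^sup>+x. (\<Sum>j. ennreal \<bar>F j x\<bar>) \<partial>M) = (\<Sum>j. \<integral>\<^sup>+x. ennreal \<bar>F j x\<bar> \<partial>M)"
    by (intro nn_integral_suminf) auto
  also have "\<dots> \<le> (\<Sum>j. ennreal (sqrt (s j)))"
    by (intro suminf_le L1) auto
  also have "\<dots> = ennreal (\<Sum>j. sqrt (s j))"
    using s0 sum_sqrt by (intro suminf_ennreal2) auto
  finally have "(\<integral>\<^sup>+x. (\<Sum>j. ennreal \<bar>F j x\<bar>) \<partial>M) \<noteq> \<infinity>"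
    by (auto simp: top_unique)
  then have "AE x in M. (\<Sum>j. ennreal \<bar>F j x\<bar>) \<noteq> \<infinity>"
    by (intro nn_integral_PInf_AE) auto
  then have lim: "AE x in M. (\<lambda>m. \<Sum>j<m. F j x) \<longlonglongrightarrow> Y x"
  proof eventually_elim
    case (elim x)
    then have "summable (\<lambda>j. \<bar>F j x\<bar>)"
      by (intro summable_suminf_not_top) auto
    then show ?case
      unfolding Y_def by (intro summable_LIMSEQ) (rule summable_rabs_cancel)
  qed
  have tail: "(\<integral>\<^sup>+x. ennreal (((\<Sum>j<n. F j x) - Y x)\<^sup>2) \<partial>M) \<le> ennreal (\<Sum>j. s (j + n))" for n
  proof -
    have "(\<integral>\<^sup>+x. ennreal (((\<Sum>j<n. F j x) - Y x)\<^sup>2) \<partial>M)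
        = (\<integral>\<^sup>+x. liminf (\<lambda>m. ennreal (((\<Sum>j<n. F j x) - (\<Sum>j<m. F j x))\<^sup>2)) \<partial>M)"
    proof (rule nn_integral_cong_AE, use lim in eventually_elim)
      case (elim x)
      have "(\<lambda>m. ennreal (((\<Sum>j<n. F j x) - (\<Sum>j<m. F j x))\<^sup>2))
          \<longlonglongrightarrow> ennreal (((\<Sum>j<n. F j x) - Y x)\<^sup>2)"
        by (intro tendsto_intros elim)
      then show ?case
        by (metis lim_imp_Liminf sequentially_bot)
    qed
    also have "\<dots> \<le> liminf (\<lambda>m. \<integral>\<^sup>+x. ennreal (((\<Sum>j<n. F j x) - (\<Sum>j<m. F j x))\<^sup>2) \<partial>M)"
      by (intro nn_integral_liminf) auto
    also have "\<dots> \<le> liminf (\<lambda>m::nat. ennreal (\<Sum>j. s (j + n)))"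
    proof (rule Liminf_mono, use eventually_ge_at_top[of n] in eventually_elim)
      case (elim m)
      \<comment> \<open>Only \<open>m \<ge> n\<close> matters for the limit inferior; there the
        difference is, up to sign, a finite block to which the hypothesis on finite sums
        applies.\<close>
      have *: "(\<Sum>j<n. F j x) - (\<Sum>j<m. F j x) = - (\<Sum>j\<in>{n..<m}. F j x)" for x
        using elim sum.atLeastLessThan_concat[of 0 n m "\<lambda>j. F j x"] by (simp add: atLeast0LessThan)
      have "(\<integral>\<^sup>+x. ennreal (((\<Sum>j<n. F j x) - (\<Sum>j<m. F j x))\<^sup>2) \<partial>M)
          = ennreal (\<integral>x. (\<Sum>j\<in>{n..<m}. F j x)\<^sup>2 \<partial>M)"
        unfolding * using L2_fun_sum[of "{n..<m}" M F] F
        by (subst nn_integral_eq_integral) (auto simp: L2_fun_def)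
      also have "\<dots> \<le> ennreal (\<Sum>j\<in>{n..<m}. s j)"
        by (intro ennreal_leI s) simp
      also have "(\<Sum>j\<in>{n..<m}. s j) = (\<Sum>j<m - n. s (j + n))"
        using sum.shift_bounds_nat_ivl[of s 0 n "m - n"] elim by (simp add: atLeast0LessThan)
      also have "ennreal \<dots> \<le> ennreal (\<Sum>j. s (j + n))"
        using sum_s s0 by (intro ennreal_leI sum_le_suminf) (auto simp: summable_iff_shift)
      finally show ?case .
    qed
    finally show ?thesis
      by (simp add: Liminf_const)
  qed
  have int: "integrable M (\<lambda>x. ((\<Sum>j<n. F j x) - Y x)\<^sup>2)" for n
    by (rule integrableI_bounded) (use tail[of n] in \<open>auto simp: less_top[symmetric] top_unique\<close>)
  \<comment> \<open>The empty partial sum leaves \<open>- Y\<close>, so the case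
    \<open>n = 0\<close> yields square integrability of \<open>Y\<close>.\<close>
  then have "L2_fun M (\<lambda>x. (\<Sum>j<0. F j x) - Y x)"
    unfolding L2_fun_def by (intro conjI) measurable
  from L2_fun_cmult[OF this, of "-1"] have "L2_fun M Y"
    by simp
  moreover have "(\<lambda>n. \<integral>x. ((\<Sum>j<n. F j x) - Y x)\<^sup>2 \<partial>M) \<longlonglongrightarrow> 0"
  proof (rule tendsto_sandwich[where f = "\<lambda>_. 0" and h = "\<lambda>n. \<Sum>j. s (j + n)"])
    have "(\<integral>x. ((\<Sum>j<n. F j x) - Y x)\<^sup>2 \<partial>M) \<le> (\<Sum>j. s (j + n))" for n
    proof -
      have "ennreal (\<integral>x. ((\<Sum>j<n. F j x) - Y x)\<^sup>2 \<partial>M) \<le> ennreal (\<Sum>j. s (j + n))"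
        using tail[of n] int[of n] by (subst nn_integral_eq_integral[symmetric]) auto
      then show ?thesis
        using sum_s s0 by (subst (asm) ennreal_le_iff) (auto intro!: suminf_nonneg simp: summable_iff_shift)
    qed
    then show "\<forall>\<^sub>F n in sequentially. (\<integral>x. ((\<Sum>j<n. F j x) - Y x)\<^sup>2 \<partial>M) \<le> (\<Sum>j. s (j + n))"
      by simp
    show "(\<lambda>n. \<Sum>j. s (j + n)) \<longlonglongrightarrow> 0"
      using sum_s by (rule suminf_exist_split2)
  qed auto
  ultimately show ?thesis
    using F by (auto simp: L2_sums_def)
qed

section \<open>Orthonormal families and the Gaussian variables\<close>

definition L2_orthonormal :: "'a measure \<Rightarrow> 'i set \<Rightarrow> ('i \<Rightarrow> 'a \<Rightarrow> real) \<Rightarrow> bool" where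
  "L2_orthonormal M I f \<longleftrightarrow>
     (\<forall>i\<in>I. L2_fun M (f i)) \<and>
     (\<forall>i\<in>I. \<forall>j\<in>I. (\<integral>x. f i x * f j x \<partial>M) = (if i = j then 1 else 0))"

text \<open>Pythagoras: after expanding the square only the diagonal terms survive.\<close>

lemma L2_orthonormal_integral_square_sum:
  assumes f: "L2_orthonormal M I f" and J: "finite J" "J \<subseteq> I"
  shows "(\<integral>x. (\<Sum>i\<in>J. c i * f i x)\<^sup>2 \<partial>M) = (\<Sum>i\<in>J. (c i)\<^sup>2)"
proof -
  have int: "integrable M (\<lambda>x. f i x * f j x)" if "i \<in> J" "j \<in> J" for i j
    using f that J by (intro L2_fun_mult_integrable) (auto simp: L2_orthonormal_def)
  have "(\<integral>x. (\<Sum>i\<in>J. c i * f i x)\<^sup>2 \<partial>M)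
      = (\<integral>x. (\<Sum>i\<in>J. \<Sum>j\<in>J. (c i * c j) * (f i x * f j x)) \<partial>M)"
    by (simp add: power2_eq_square sum_product mult_ac)
  also have "\<dots> = (\<Sum>i\<in>J. \<Sum>j\<in>J. (c i * c j) * (\<integral>x. f i x * f j x \<partial>M))"
    using int by simp
  also have "\<dots> = (\<Sum>i\<in>J. \<Sum>j\<in>J. if i = j then (c i)\<^sup>2 else 0)"
    using f J by (intro sum.cong refl) (auto simp: L2_orthonormal_def power2_eq_square subset_iff)
  also have "\<dots> = (\<Sum>i\<in>J. (c i)\<^sup>2)"
    using J by simp
  finally show ?thesis .
qed

text \<open>Independence factors the mixed moments into products of zero means, and the diagonal
  ones are variances. In this form the law of the variables enters the proof.\<close>

lemma (in prob_space) iid_std_normal_L2_orthonormal: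
  assumes "iid_std_normal M \<epsilon>"
  shows "L2_orthonormal M {(j, k). k < 2 ^ j} (\<lambda>(j, k). \<epsilon> j k)"
proof -
  let ?I = "{(j, k). k < 2 ^ j}" and ?f = "\<lambda>(j, k). \<epsilon> j k"
  have ind: "indep_vars (\<lambda>_. borel) ?f ?I"
    and dist: "\<And>p. p \<in> ?I \<Longrightarrow> distributed M lborel (?f p) std_normal_density"
    using assms by (auto simp: iid_std_normal_def)
  have L2: "L2_fun M (?f p)" if "p \<in> ?I" for p
    using distributed_measurable[OF dist[OF that]]
      distributed_integrable[OF dist[OF that], of "\<lambda>x. x ^ 2"] integrable_std_normal_moment[of 2]
    by (auto simp: L2_fun_def)
  have E1: "expectation (?f p) = 0" if "p \<in> ?I" for p
    using standard_normal_distributed_expectation[OF dist[OF that]] by simp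
  have E2: "expectation (\<lambda>x. ?f p x * ?f p x) = 1" if "p \<in> ?I" for p
    using standard_normal_distributed_variance[OF dist[OF that]] E1[OF that]
    by (simp add: power2_eq_square)
  have one: "L2_fun M (\<lambda>_. 1)"
    by (simp add: L2_fun_def)
  have E3: "expectation (\<lambda>x. ?f p x * ?f q x) = 0" if "p \<in> ?I" "q \<in> ?I" "p \<noteq> q" for p q
  proof -
    \<comment> \<open>As \<open>p \<noteq> q\<close>, the product over the set has exactly two
      factors.\<close>
    have "expectation (\<lambda>x. \<Prod>i\<in>{p, q}. ?f i x) = (\<Prod>i\<in>{p, q}. expectation (?f i))"
    proof (rule indep_vars_lebesgue_integral)
      show "indep_vars (\<lambda>_. borel) ?f {p, q}"
        using ind that by (intro indep_vars_subset[OF ind]) auto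
      show "integrable M (?f i)" if "i \<in> {p, q}" for i
        using L2_fun_mult_integrable[OF L2 one, of i] that \<open>p \<in> ?I\<close> \<open>q \<in> ?I\<close> by auto
    qed simp
    then show ?thesis
      using that E1 by simp
  qed
  show ?thesis
    unfolding L2_orthonormal_def using L2 E2 E3 by auto
qed

section \<open>The second moment of the process\<close>

theorem theorem3p1:
  fixes M :: "'a measure"
    and \<epsilon> :: "nat \<Rightarrow> nat \<Rightarrow> 'a \<Rightarrow> real"
    and H :: "nat \<Rightarrow> real \<Rightarrow> real"
    and Hlow Hup C\<^sub>0 :: real
  assumes "prob_space M"
    and "iid_std_normal M \<epsilon>"
    and "0 < Hlow" and "Hlow \<le> Hup" and "Hup < 1"
    and "\<forall>j. \<forall>x\<in>{0..1}. H j x \<in> {Hlow..Hup}"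
    and "\<forall>j. \<exists>L. L-lipschitz_on {0..1} (H j)"
    and "C\<^sub>0 > 0"
    and "\<forall>j. Lipschitz_nu (H j) \<le> C\<^sub>0 * (1 + real j)"
  shows "(\<forall>t\<in>{0..1}.
            summable (\<lambda>j. \<Sum>k<2 ^ j. \<bar>haar_coeff H j k t\<bar>\<^sup>2) \<and>
            (\<forall>X. is_GHBMP M \<epsilon> H X \<longrightarrow>
               prob_space.expectation M (\<lambda>\<omega>. (X t \<omega>)\<^sup>2)
                 = (\<Sum>j. \<Sum>k<2 ^ j. \<bar>haar_coeff H j k t\<bar>\<^sup>2)))
         \<and> (\<exists>X. is_GHBMP M \<epsilon> H X)"
proof -
  interpret prob_space M by fact
  define F where "F = (\<lambda>t j \<omega>. \<Sum>k<2 ^ j. haar_coeff H j k t * \<epsilon> j k \<omega>)"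
  \<comment> \<open>By \<open>E_F\<close> below, the second moment of level \<open>j\<close> of the
    series.\<close>
  define s where "s = (\<lambda>t j. \<Sum>k<2 ^ j. (haar_coeff H j k t)\<^sup>2)"
  define r where "r = 2 powr (- 2 * Hlow)"
  define W where "W = (\<Sum>n. dyadic_weight Hlow n)"
  note orth = iid_std_normal_L2_orthonormal[OF assms(2)]
  have r: "0 \<le> r" "r < 1"
    using assms(3) powr_less_mono[of "- 2 * Hlow" 0 2] by (auto simp: r_def)
  have s_le: "s t j \<le> W * r ^ j" if "t \<in> {0..1}" for t j
  proof -
    have "Hlow \<le> H j x \<and> H j x < 1" if "x \<in> {0..1}" for x
      using assms(6)[rule_format, OF that, of j] assms(5) by auto
    then show ?thesis
      unfolding s_def W_def r_def
      using assms(3-5) that by (intro sum_haar_coeff_square_le) auto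
  qed
  have s0: "0 \<le> s t j" for t j
    by (simp add: s_def sum_nonneg)
  have sum_s: "summable (s t)" if "t \<in> {0..1}" for t
  proof (rule summable_comparison_test')
    show "summable (\<lambda>j. W * r ^ j)"
      using r by (intro summable_mult summable_geometric) auto
    show "norm (s t j) \<le> W * r ^ j" if "0 \<le> j" for j
      using s_le[OF \<open>t \<in> {0..1}\<close>] s0 by simp
  qed
  \<comment> \<open>The square root of a geometric bound is again geometric, with ratio
    \<open>sqrt r < 1\<close>.\<close>
  have sum_sqrt: "summable (\<lambda>j. sqrt (s t j))" if "t \<in> {0..1}" for t
  proof (rule summable_comparison_test')
    show "summable (\<lambda>j. sqrt W * sqrt r ^ j)"
      using r by (intro summable_mult summable_geometric) auto
    show "norm (sqrt (s t j)) \<le> sqrt W * sqrt r ^ j" if "0 \<le> j" for j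
      using s_le[OF \<open>t \<in> {0..1}\<close>, of j] s0[of t j]
      by (simp flip: real_sqrt_power real_sqrt_mult)
  qed
  have L2_\<epsilon>: "L2_fun M (\<epsilon> j k)" if "k < 2 ^ j" for j k
    using orth that by (auto simp: L2_orthonormal_def)
  have L2_F: "L2_fun M (F t j)" for t j
    unfolding F_def by (intro L2_fun_sum L2_fun_cmult L2_\<epsilon>) simp
  \<comment> \<open>Flattening the double sum to one over pairs applies orthonormality within and
    across levels at once.\<close>
  have E_F: "expectation (\<lambda>\<omega>. (\<Sum>j\<in>J. F t j \<omega>)\<^sup>2) = (\<Sum>j\<in>J. s t j)" if "finite J" for t J
  proof -
    let ?J = "SIGMA j:J. {..<2 ^ j}" and ?f = "\<lambda>(j, k). \<epsilon> j k"
    let ?c = "\<lambda>(j, k). haar_coeff H j k t"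
    have "(\<Sum>j\<in>J. F t j \<omega>) = (\<Sum>p\<in>?J. ?c p * ?f p \<omega>)" for \<omega>
      unfolding F_def using that by (subst sum.Sigma) (auto simp: case_prod_unfold)
    moreover have "(\<Sum>j\<in>J. s t j) = (\<Sum>p\<in>?J. (?c p)\<^sup>2)"
      unfolding s_def using that by (subst sum.Sigma) (auto simp: case_prod_unfold)
    moreover have "expectation (\<lambda>\<omega>. (\<Sum>p\<in>?J. ?c p * ?f p \<omega>)\<^sup>2) = (\<Sum>p\<in>?J. (?c p)\<^sup>2)"
      using that by (intro L2_orthonormal_integral_square_sum[OF orth]) auto
    ultimately show ?thesis
      by simp
  qed
  \<comment> \<open>The limit is obtained for each \<open>t\<close> separately; choosing one for
    every \<open>t\<close> then gives the process.\<close>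
  have "\<forall>t\<in>{0..1}. \<exists>Y. L2_sums M (F t) Y"
    using L2_sums_exists[OF L2_F eq_refl[OF E_F] s0 sum_s sum_sqrt] by blast
  then obtain X where "\<forall>t\<in>{0..1}. L2_sums M (F t) (X t)"
    by metis
  then have "is_GHBMP M \<epsilon> H X"
    by (simp add: is_GHBMP_def F_def)
  \<comment> \<open>For any version of the process, both sides are limits of the second moments of
    the partial sums.\<close>
  moreover have "expectation (\<lambda>\<omega>. (X t \<omega>)\<^sup>2) = (\<Sum>j. s t j)"
    if t: "t \<in> {0..1}" and X: "is_GHBMP M \<epsilon> H X" for t X
  proof (rule LIMSEQ_unique)
    have "L2_sums M (F t) (X t)"
      using X t by (simp add: is_GHBMP_def F_def)
    from L2_sums_integral_square[OF this]
    show "(\<lambda>n. \<Sum>j<n. s t j) \<longlonglongrightarrow> expectation (\<lambda>\<omega>. (X t \<omega>)\<^sup>2)"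
      by (simp add: E_F)
    show "(\<lambda>n. \<Sum>j<n. s t j) \<longlonglongrightarrow> (\<Sum>j. s t j)"
      using sum_s[OF t] by (rule summable_LIMSEQ)
  qed
  ultimately show ?thesis
    using sum_s by (auto simp: s_def)
qed

end
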